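(* Let $\mathsf D$ be a domain theory, let $\mathsf P=(A,O,CL)$ be a solution plan for a planning problem with goal condition $goal$ over the planning domain obtained from $\mathsf D$, let $\mathsf{PT}$ be the process template synthesized from $\mathsf P$, and let $w_{\mathsf{PT}}$ be the weakest preconditions inferred from $\mathsf P$. Then $\mathsf{PT}$ is correct for any process case $\mathsf C$ over $\mathsf D$ with goal condition $goal_{\mathsf C}=goal$ that satisfies $w_{\mathsf{PT}}$ (i.e. $init_{\mathsf C}\vdash w_{\mathsf{PT}}$).
   Context: **Domain theory and tasks.** A domain theory $\mathsf D$ consists of finite data types of data objects, a finite set $\mathsf V$ of ground atomic terms, each with a Boolean, integer, or finite object-valued domain, and a set $\mathsf T$ of (ground) tasks. Each task $t$ has preconditions $Pre_t$, a conjunction of atomic conditions "$v\ \mathbf{op}\ expr$" with $v\in\mathsf V$ and $\mathbf{op}\in\{<,>,==,\le,\ge\}$ (only equality for Boolean and object-valued terms; negative preconditions are not allowed), and deterministic effects $Eff_t$, a conjunction of assignments "$v\ \mathbf{op}\ expr$" with $\mathbf{op}\in\{=,+=,-=\}$. A state is a complete assignment of values to the terms in $\mathsf V$; $state\vdash\chi$ means that the state satisfies $\chi$; $update(state,Eff_t)$ is the state obtained by applying the effects of $t$. A process case $\mathsf C$ consists of a starting condition $init_{\mathsf C}$ (a conjunction of assignments of values to some of the terms, possibly not all) and a goal condition $goal_{\mathsf C}$ (a conjunction of conditions with the syntax of preconditions). A case is translated into a planning problem with the same goal and a complete initial state, Boolean terms not mentioned in $init_{\mathsf C}$ being taken as false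 and other unmentioned terms as unassigned; tasks become planning actions with the same preconditions and effects. **Plans.** A partial plan is $\mathsf P=(A,O,CL)$: a set $A$ of actions containing the dummy actions $a_0$ (whose effects are the facts true in the initial state of the problem) and $a_\infty$ (whose preconditions are the goal facts), with $a_0$ before and $a_\infty$ after all other actions; a set $O$ of ordering constraints $a\prec b$ ("$a$ is executed sometime before $b$"); and a set $CL$ of causal links $c\xrightarrow{p}d$, meaning that $p$ is an effect of $c$ and a precondition of $d$ and must remain true from $c$ to $d$ (in particular $c$ precedes $d$). The plan is consistent if $O$ has no cycles and there is no conflict with a causal link, i.e. for no causal link $c\xrightarrow{p}d$ is there another action of $A$ that can be ordered between $c$ and $d$ consistently with $O$ and makes $p$ false. An open condition is a precondition $p$ of some $a\in A$ for which there is no causal link $b\xrightarrow{p}a$ in $CL$. A solution plan is a consistent plan without open conditions. **Template.** The process template $\mathsf{PT}$ synthesized from $\mathsf P$ is the directed graph with a start event $\bigcirc$ (for $a_0$), an end event $\odot$ (for $a_\infty$), one task node for every other action of $A$, parallel split/join gateways, and transitions, which represents exactly the ordering constraints $O$. An execution path of $\mathsf{PT}$ is a linearization $[\bigcirc;t_1;\dots;t_k;\odot]$ of all its tasks consistent with the partial order given by the template (equivalently, with $O$). **Weakest preconditions.** $w_{\mathsf{PT}}$ is the conjunction of all facts $f$ such that there is a causal link $a_0\xrightarrow{f}a$ in $CL$ for some $a\in A$. **Correctness.** For a case $\mathsf C$ and an initial state $state_0\vdash init_{\mathsf C}$, an execution path $[\bigcirc;t_1;\dots;t_k;\odot]$ is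 executable in $\mathsf C$ iff $state_0\vdash Pre_{t_1}$; for $1\le i\le k-1$, $state_i:=update(state_{i-1},Eff_{t_i})\vdash Pre_{t_{i+1}}$; and $state_k:=update(state_{k-1},Eff_{t_k})\vdash goal_{\mathsf C}$. $\mathsf{PT}$ is executable in $\mathsf C$ iff every execution path of $\mathsf{PT}$ is executable in $\mathsf C$. $\mathsf{PT}$ is correct with respect to $\mathsf D$ and $\mathsf C$ iff it is executable in $\mathsf C$. *)

theory Defs
  imports Main
begin

section \<open>Domain theories, states and updates\<close>

datatype 'o val = BoolV bool | IntV int | ObjV 'o

datatype 'o vdom = BoolDom | IntDom | ObjDom "'o set"

fun dom_vals :: "'o vdom \<Rightarrow> 'o val set" where
  "dom_vals BoolDom = range BoolV"
| "dom_vals IntDom = range IntV"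
| "dom_vals (ObjDom X) = ObjV ` X"

datatype ('v, 'o) expr =
    Const "'o val"
  | Term 'v
  | Add "('v, 'o) expr" "('v, 'o) expr"
  | Sub "('v, 'o) expr" "('v, 'o) expr"
  | Mult "('v, 'o) expr" "('v, 'o) expr"

datatype rel_op = Less | Greater | Equal | LessEq | GreaterEq

datatype ('v, 'o) cond = Cond 'v rel_op "('v, 'o) expr"

datatype asg_op = Assign | Increase | Decrease

text \<open>A conjunction of assignments is a finite map from the assigned terms to the operator and
  the right-hand side. There is at most one assignment per term, so effects are deterministic
  irrespective of the order in which the conjuncts are written.\<close>

type_synonym ('v, 'o) effs = "'v \<rightharpoonup> asg_op \<times> ('v, 'o) expr"

record ('v, 'o, 't) domain_theory =
  data_types :: "'o set set"
  terms :: "'v set"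
  term_dom :: "'v \<Rightarrow> 'o vdom"
  tasks :: "'t set"
  pre :: "'t \<Rightarrow> ('v, 'o) cond set"
  eff :: "'t \<Rightarrow> ('v, 'o) effs"

fun has_dom :: "('v, 'o, 't) domain_theory \<Rightarrow> ('v, 'o) expr \<Rightarrow> 'o vdom \<Rightarrow> bool" where
  "has_dom D (Const x) \<delta> \<longleftrightarrow> x \<in> dom_vals \<delta>"
| "has_dom D (Term v) \<delta> \<longleftrightarrow> v \<in> terms D \<and> term_dom D v = \<delta>"
| "has_dom D (Add e1 e2) \<delta> \<longleftrightarrow> \<delta> = IntDom \<and> has_dom D e1 \<delta> \<and> has_dom D e2 \<delta>"
| "has_dom D (Sub e1 e2) \<delta> \<longleftrightarrow> \<delta> = IntDom \<and> has_dom D e1 \<delta> \<and> has_dom D e2 \<delta>"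
| "has_dom D (Mult e1 e2) \<delta> \<longleftrightarrow> \<delta> = IntDom \<and> has_dom D e1 \<delta> \<and> has_dom D e2 \<delta>"

text \<open>Excluding the right-hand side \<open>false\<close> rules out negative preconditions.\<close>

fun wf_cond :: "('v, 'o, 't) domain_theory \<Rightarrow> ('v, 'o) cond \<Rightarrow> bool" where
  "wf_cond D (Cond v r e) \<longleftrightarrow>
     v \<in> terms D \<and> has_dom D e (term_dom D v) \<and>
     (term_dom D v \<noteq> IntDom \<longrightarrow> r = Equal) \<and> e \<noteq> Const (BoolV False)"

definition wf_effs :: "('v, 'o, 't) domain_theory \<Rightarrow> ('v, 'o) effs \<Rightarrow> bool" where
  "wf_effs D E \<longleftrightarrow>
     (\<forall>v r e. E v = Some (r, e) \<longrightarrow>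
        v \<in> terms D \<and> has_dom D e (term_dom D v) \<and>
        (term_dom D v \<noteq> IntDom \<longrightarrow> r = Assign))"

definition domain_theory :: "('v, 'o, 't) domain_theory \<Rightarrow> bool" where
  "domain_theory D \<longleftrightarrow>
     finite (data_types D) \<and> (\<forall>X \<in> data_types D. finite X) \<and>
     finite (terms D) \<and>
     (\<forall>v \<in> terms D. \<forall>X. term_dom D v = ObjDom X \<longrightarrow> X \<in> data_types D) \<and>
     (\<forall>t \<in> tasks D. finite (pre D t) \<and> (\<forall>\<chi> \<in> pre D t. wf_cond D \<chi>) \<and> wf_effs D (eff D t))"

text \<open>\<open>None\<close> stands for ``unassigned''. Boolean terms always have a truth value; integer and
  object-valued terms may be unassigned, as in the initial state obtained from a process case.
  An expression mentioning an unassigned term has no value, and a comparison with an undefined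
  side is not satisfied.\<close>

type_synonym ('v, 'o) state = "'v \<rightharpoonup> 'o val"

definition states :: "('v, 'o, 't) domain_theory \<Rightarrow> ('v, 'o) state set" where
  "states D =
     {s. dom s \<subseteq> terms D \<and>
         (\<forall>v \<in> terms D. term_dom D v = BoolDom \<longrightarrow> s v \<noteq> None) \<and>
         (\<forall>v x. s v = Some x \<longrightarrow> x \<in> dom_vals (term_dom D v))}"

fun arith :: "(int \<Rightarrow> int \<Rightarrow> int) \<Rightarrow> 'o val option \<Rightarrow> 'o val option \<Rightarrow> 'o val option" where
  "arith f (Some (IntV i)) (Some (IntV j)) = Some (IntV (f i j))"
| "arith f _ _ = None"

fun eval_expr :: "('v, 'o) state \<Rightarrow> ('v, 'o) expr \<Rightarrow> 'o val option" where
  "eval_expr s (Const x) = Some x"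
| "eval_expr s (Term v) = s v"
| "eval_expr s (Add e1 e2) = arith (+) (eval_expr s e1) (eval_expr s e2)"
| "eval_expr s (Sub e1 e2) = arith (-) (eval_expr s e1) (eval_expr s e2)"
| "eval_expr s (Mult e1 e2) = arith (*) (eval_expr s e1) (eval_expr s e2)"

fun compare_vals :: "rel_op \<Rightarrow> 'o val \<Rightarrow> 'o val \<Rightarrow> bool" where
  "compare_vals Equal x y \<longleftrightarrow> x = y"
| "compare_vals Less (IntV i) (IntV j) \<longleftrightarrow> i < j"
| "compare_vals Greater (IntV i) (IntV j) \<longleftrightarrow> i > j"
| "compare_vals LessEq (IntV i) (IntV j) \<longleftrightarrow> i \<le> j"
| "compare_vals GreaterEq (IntV i) (IntV j) \<longleftrightarrow> i \<ge> j"
| "compare_vals _ _ _ \<longleftrightarrow> False"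

fun holds :: "('v, 'o) state \<Rightarrow> ('v, 'o) cond \<Rightarrow> bool" where
  "holds s (Cond v r e) \<longleftrightarrow>
     (\<exists>x y. s v = Some x \<and> eval_expr s e = Some y \<and> compare_vals r x y)"

definition sat :: "('v, 'o) state \<Rightarrow> ('v, 'o) cond set \<Rightarrow> bool" where
  "sat s X \<longleftrightarrow> (\<forall>\<chi> \<in> X. holds s \<chi>)"

fun assign_val :: "asg_op \<Rightarrow> 'o val option \<Rightarrow> 'o val option \<Rightarrow> 'o val option" where
  "assign_val Assign old new = new"
| "assign_val Increase old new = arith (+) old new"
| "assign_val Decrease old new = arith (-) old new"

text \<open>All right-hand sides are evaluated in the state before the update.\<close>

definition update :: "('v, 'o) state \<Rightarrow> ('v, 'o) effs \<Rightarrow> ('v, 'o) state" where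
  "update s E = (\<lambda>v. case E v of None \<Rightarrow> s v | Some (r, e) \<Rightarrow> assign_val r (s v) (eval_expr s e))"


section \<open>Process cases and planning problems\<close>

record ('v, 'o) process_case =
  case_init :: "'v \<rightharpoonup> 'o val"
  case_goal :: "('v, 'o) cond set"

definition process_case :: "('v, 'o, 't) domain_theory \<Rightarrow> ('v, 'o) process_case \<Rightarrow> bool" where
  "process_case D C \<longleftrightarrow>
     dom (case_init C) \<subseteq> terms D \<and>
     (\<forall>v x. case_init C v = Some x \<longrightarrow> x \<in> dom_vals (term_dom D v)) \<and>
     finite (case_goal C) \<and> (\<forall>\<chi> \<in> case_goal C. wf_cond D \<chi>)"

definition initial_states ::
    "('v, 'o, 't) domain_theory \<Rightarrow> ('v, 'o) process_case \<Rightarrow> ('v, 'o) state set" where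
  "initial_states D C = {s \<in> states D. case_init C \<subseteq>\<^sub>m s}"

text \<open>The initial state of the planning problem into which a case is translated is one of these.\<close>

definition closed_world_state ::
    "('v, 'o, 't) domain_theory \<Rightarrow> ('v, 'o) process_case \<Rightarrow> ('v, 'o) state" where
  "closed_world_state D C =
     (\<lambda>v. if v \<in> terms D \<and> term_dom D v = BoolDom \<and> case_init C v = None
          then Some (BoolV False) else case_init C v)"

lemma closed_world_state_initial:
  "process_case D C \<Longrightarrow> closed_world_state D C \<in> initial_states D C"
  by (auto simp: process_case_def initial_states_def states_def closed_world_state_def map_le_def
      subset_iff dom_def split: if_splits)

text \<open>Since the starting condition need not mention all terms, it satisfies a conjunction of facts
  if it entails it, i.e. if the conjunction is true in every state satisfying the starting
  condition.\<close>

definition init_satisfies ::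
    "('v, 'o, 't) domain_theory \<Rightarrow> ('v, 'o) process_case \<Rightarrow> ('v, 'o) cond set \<Rightarrow> bool" where
  "init_satisfies D C w \<longleftrightarrow> (\<forall>s \<in> initial_states D C. sat s w)"

record ('v, 'o) problem =
  prob_init :: "('v, 'o) state"
  prob_goal :: "('v, 'o) cond set"

definition planning_problem :: "('v, 'o, 't) domain_theory \<Rightarrow> ('v, 'o) problem \<Rightarrow> bool" where
  "planning_problem D \<Pi> \<longleftrightarrow>
     prob_init \<Pi> \<in> states D \<and>
     finite (prob_goal \<Pi>) \<and> (\<forall>\<chi> \<in> prob_goal \<Pi>. wf_cond D \<chi>)"


section \<open>Partial-order plans\<close>

text \<open>\<open>Act a\<close> is an occurrence of the task \<open>task_of a\<close>, so a plan may contain several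
  occurrences of the same task; \<open>Init\<close> and \<open>Final\<close> are the two dummy actions.\<close>

datatype 'a act = Init | Act 'a | Final

record ('v, 'o, 't, 'a) plan =
  acts :: "'a act set"
  task_of :: "'a \<Rightarrow> 't"
  orderings :: "('a act \<times> 'a act) set"
  links :: "('a act \<times> ('v, 'o) cond \<times> 'a act) set"

fun act_pre ::
    "('v, 'o, 't) domain_theory \<Rightarrow> ('v, 'o) problem \<Rightarrow> ('v, 'o, 't, 'a) plan \<Rightarrow>
     'a act \<Rightarrow> ('v, 'o) cond set" where
  "act_pre D \<Pi> P Init = {}"
| "act_pre D \<Pi> P (Act a) = pre D (task_of P a)"
| "act_pre D \<Pi> P Final = prob_goal \<Pi>"

fun act_result ::
    "('v, 'o, 't) domain_theory \<Rightarrow> ('v, 'o) problem \<Rightarrow> ('v, 'o, 't, 'a) plan \<Rightarrow>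
     'a act \<Rightarrow> ('v, 'o) state \<Rightarrow> ('v, 'o) state" where
  "act_result D \<Pi> P Init s = prob_init \<Pi>"
| "act_result D \<Pi> P (Act a) s = update s (eff D (task_of P a))"
| "act_result D \<Pi> P Final s = s"

text \<open>Effects are assignments whereas the label \<open>p\<close> of a causal link is a condition, possibly a
  numeric comparison. So \<open>p\<close> is an effect of \<open>c\<close> if it is true whenever \<open>c\<close> has been executed.
  In particular, the effects of \<open>Init\<close> are exactly the conditions true in the initial state, and an
  assignment of a value \<open>x\<close> to a term \<open>v\<close> has the effect that \<open>v\<close> equals \<open>x\<close>.\<close>

definition has_effect ::
    "('v, 'o, 't) domain_theory \<Rightarrow> ('v, 'o) problem \<Rightarrow> ('v, 'o, 't, 'a) plan \<Rightarrow>
     'a act \<Rightarrow> ('v, 'o) cond \<Rightarrow> bool" where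
  "has_effect D \<Pi> P c p \<longleftrightarrow>
     (\<forall>s \<in> states D. sat s (act_pre D \<Pi> P c) \<longrightarrow> holds (act_result D \<Pi> P c s) p)"

definition makes_false ::
    "('v, 'o, 't) domain_theory \<Rightarrow> ('v, 'o) problem \<Rightarrow> ('v, 'o, 't, 'a) plan \<Rightarrow>
     'a act \<Rightarrow> ('v, 'o) cond \<Rightarrow> bool" where
  "makes_false D \<Pi> P b p \<longleftrightarrow>
     (\<exists>s \<in> states D. sat s (act_pre D \<Pi> P b) \<and> holds s p \<and> \<not> holds (act_result D \<Pi> P b s) p)"

definition partial_plan ::
    "('v, 'o, 't) domain_theory \<Rightarrow> ('v, 'o) problem \<Rightarrow> ('v, 'o, 't, 'a) plan \<Rightarrow> bool" where
  "partial_plan D \<Pi> P \<longleftrightarrow>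
     finite (acts P) \<and> Init \<in> acts P \<and> Final \<in> acts P \<and>
     (\<forall>a. Act a \<in> acts P \<longrightarrow> task_of P a \<in> tasks D) \<and>
     orderings P \<subseteq> acts P \<times> acts P \<and>
     (\<forall>a \<in> acts P - {Init}. (Init, a) \<in> (orderings P)\<^sup>+) \<and>
     (\<forall>a \<in> acts P - {Final}. (a, Final) \<in> (orderings P)\<^sup>+) \<and>
     (\<forall>(c, p, d) \<in> links P.
        c \<in> acts P \<and> d \<in> acts P \<and> (c, d) \<in> (orderings P)\<^sup>+ \<and>
        has_effect D \<Pi> P c p \<and> p \<in> act_pre D \<Pi> P d)"

definition conflict ::
    "('v, 'o, 't) domain_theory \<Rightarrow> ('v, 'o) problem \<Rightarrow> ('v, 'o, 't, 'a) plan \<Rightarrow>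
     'a act \<Rightarrow> 'a act \<times> ('v, 'o) cond \<times> 'a act \<Rightarrow> bool" where
  "conflict D \<Pi> P b l \<longleftrightarrow>
     (case l of (c, p, d) \<Rightarrow>
        b \<in> acts P - {c, d} \<and> acyclic (orderings P \<union> {(c, b), (b, d)}) \<and>
        makes_false D \<Pi> P b p)"

definition consistent_plan ::
    "('v, 'o, 't) domain_theory \<Rightarrow> ('v, 'o) problem \<Rightarrow> ('v, 'o, 't, 'a) plan \<Rightarrow> bool" where
  "consistent_plan D \<Pi> P \<longleftrightarrow>
     acyclic (orderings P) \<and> \<not> (\<exists>l \<in> links P. \<exists>b. conflict D \<Pi> P b l)"

definition open_condition ::
    "('v, 'o, 't) domain_theory \<Rightarrow> ('v, 'o) problem \<Rightarrow> ('v, 'o, 't, 'a) plan \<Rightarrow>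
     'a act \<Rightarrow> ('v, 'o) cond \<Rightarrow> bool" where
  "open_condition D \<Pi> P a p \<longleftrightarrow>
     a \<in> acts P \<and> p \<in> act_pre D \<Pi> P a \<and> \<not> (\<exists>b. (b, p, a) \<in> links P)"

definition solution_plan ::
    "('v, 'o, 't) domain_theory \<Rightarrow> ('v, 'o) problem \<Rightarrow> ('v, 'o, 't, 'a) plan \<Rightarrow> bool" where
  "solution_plan D \<Pi> P \<longleftrightarrow>
     partial_plan D \<Pi> P \<and> consistent_plan D \<Pi> P \<and> \<not> (\<exists>a p. open_condition D \<Pi> P a p)"

definition weakest_preconditions :: "('v, 'o, 't, 'a) plan \<Rightarrow> ('v, 'o) cond set" where
  "weakest_preconditions P = {f. \<exists>a \<in> acts P. (Init, f, a) \<in> links P}"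


section \<open>Process templates\<close>

datatype ('a, 'g) node =
  StartEvent | EndEvent | TaskNode 'a | ParallelSplit 'g | ParallelJoin 'g

record ('t, 'a, 'g) template =
  nodes :: "('a, 'g) node set"
  node_task :: "'a \<Rightarrow> 't"
  transitions :: "(('a, 'g) node \<times> ('a, 'g) node) set"

fun node_of :: "'a act \<Rightarrow> ('a, 'g) node" where
  "node_of Init = StartEvent"
| "node_of (Act a) = TaskNode a"
| "node_of Final = EndEvent"

text \<open>Gateways are only routing nodes: the partial order given by a template is reachability
  between its events and task nodes.\<close>

definition synthesized_from ::
    "('t, 'a, 'g) template \<Rightarrow> ('v, 'o, 't, 'a) plan \<Rightarrow> bool" where
  "synthesized_from PT P \<longleftrightarrow>
     finite (nodes PT) \<and> transitions PT \<subseteq> nodes PT \<times> nodes PT \<and>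
     (\<forall>a. node_of a \<in> nodes PT \<longleftrightarrow> a \<in> acts P) \<and>
     (\<forall>a. Act a \<in> acts P \<longrightarrow> node_task PT a = task_of P a) \<and>
     (\<forall>a \<in> acts P. \<forall>b \<in> acts P.
        (node_of a, node_of b) \<in> (transitions PT)\<^sup>+ \<longleftrightarrow> (a, b) \<in> (orderings P)\<^sup>+)"

text \<open>The list \<open>as\<close> contains the task nodes between the start event and the end event.\<close>

definition execution_path :: "('t, 'a, 'g) template \<Rightarrow> 'a list \<Rightarrow> bool" where
  "execution_path PT as \<longleftrightarrow>
     distinct as \<and> set as = {a. TaskNode a \<in> nodes PT} \<and>
     sorted_wrt (\<lambda>x y. (y, x) \<notin> (transitions PT)\<^sup>+) (StartEvent # map TaskNode as @ [EndEvent])"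

fun executable_from ::
    "('v, 'o, 't) domain_theory \<Rightarrow> ('v, 'o) cond set \<Rightarrow> ('v, 'o) state \<Rightarrow> 't list \<Rightarrow> bool" where
  "executable_from D G s [] \<longleftrightarrow> sat s G"
| "executable_from D G s (t # ts) \<longleftrightarrow>
     sat s (pre D t) \<and> executable_from D G (update s (eff D t)) ts"

definition path_executable ::
    "('v, 'o, 't) domain_theory \<Rightarrow> ('v, 'o) process_case \<Rightarrow> 't list \<Rightarrow> bool" where
  "path_executable D C ts \<longleftrightarrow>
     (\<forall>s0 \<in> initial_states D C. executable_from D (case_goal C) s0 ts)"

definition template_executable ::
    "('v, 'o, 't) domain_theory \<Rightarrow> ('v, 'o) process_case \<Rightarrow> ('t, 'a, 'g) template \<Rightarrow> bool" where
  "template_executable D C PT \<longleftrightarrow>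
     (\<forall>as. execution_path PT as \<longrightarrow> path_executable D C (map (node_task PT) as))"

definition correct ::
    "('v, 'o, 't) domain_theory \<Rightarrow> ('v, 'o) process_case \<Rightarrow> ('t, 'a, 'g) template \<Rightarrow> bool" where
  "correct D C PT \<longleftrightarrow> template_executable D C PT"

end

(* Along an execution path, every causal link whose producer has been executed (the start event
   included) and whose consumer has not protects its condition: the producer establishes it (for
   the start event, because the case satisfies the weakest preconditions), and a later action that
   destroyed it would be a threat to the link, since the path itself witnesses that this action can
   be ordered between producer and consumer. As there are no open conditions, every precondition is
   labelled by a link from an earlier action, hence holds when it is needed. *)
theory Submission
  imports Defs
begin

lemma arith_eq_SomeD: "arith f x y = Some z \<Longrightarrow> z \<in> range IntV"
  by (elim arith.elims) auto

lemma has_dom_eval_expr: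
  assumes "s \<in> states D" "has_dom D e \<delta>" "eval_expr s e = Some x"
  shows "x \<in> dom_vals \<delta>"
  using assms by (cases e) (auto simp: states_def dest!: arith_eq_SomeD)

text \<open>No arithmetic expression has domain \<open>BoolDom\<close>, so only constants and
  Boolean terms remain, and the latter are never unassigned in \<open>states D\<close>.\<close>

lemma has_dom_BoolDom_eval_expr:
  assumes "s \<in> states D" "has_dom D e BoolDom"
  shows "eval_expr s e \<noteq> None"
  using assms by (cases e) (auto simp: states_def)

text \<open>Needed because \<open>has_effect\<close> and \<open>makes_false\<close> speak only about
  \<open>states D\<close>, so the states along a path must stay there. A numeric update may leave an
  integer term unassigned, which \<open>states D\<close> permits.\<close>

lemma update_in_states:
  assumes s: "s \<in> states D" and E: "wf_effs D E"
  shows "update s E \<in> states D"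
proof -
  have "v \<in> terms D" if "update s E v \<noteq> None" for v
    using that s E by (cases "E v") (auto simp: update_def states_def wf_effs_def)
  moreover have "update s E v \<noteq> None" if "v \<in> terms D" "term_dom D v = BoolDom" for v
  proof (cases "E v")
    case None
    then show ?thesis using that s by (auto simp: update_def states_def)
  next
    case (Some re)
    then obtain r e where re: "E v = Some (r, e)" by (cases re) auto
    with E that have "r = Assign" "has_dom D e BoolDom"
      by (force simp: wf_effs_def)+
    with re has_dom_BoolDom_eval_expr[OF s] show ?thesis by (simp add: update_def)
  qed
  moreover have "x \<in> dom_vals (term_dom D v)" if x: "update s E v = Some x" for v x
  proof (cases "E v")
    case None
    then show ?thesis using x s by (auto simp: update_def states_def)
  next
    case (Some re)
    then obtain r e where re: "E v = Some (r, e)" by (cases re) auto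
    with E have wf: "has_dom D e (term_dom D v)" "term_dom D v \<noteq> IntDom \<longrightarrow> r = Assign"
      by (auto simp: wf_effs_def)
    have x: "assign_val r (s v) (eval_expr s e) = Some x"
      using x re by (simp add: update_def)
    show ?thesis
    proof (cases "r = Assign")
      case True
      with x wf has_dom_eval_expr[OF s] show ?thesis by auto
    next
      case False
      \<comment> \<open>\<open>Increase\<close> and \<open>Decrease\<close> only change integer
        terms, and every value returned by \<open>arith\<close> is an integer.\<close>
      with x wf show ?thesis by (cases r) (auto dest!: arith_eq_SomeD)
    qed
  qed
  ultimately show ?thesis by (auto simp: states_def)
qed

text \<open>Strict order of positions, as a set of pairs so that \<open>orderings P\<close> can be
  compared with it by inclusion; acyclicity passes to subsets.\<close>

definition precedes :: "'b list \<Rightarrow> ('b \<times> 'b) set" where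
  "precedes L = {(L ! i, L ! j) | i j. i < j \<and> j < length L}"

text \<open>Distinctness gives each element a single position, so transitivity and irreflexivity are
  inherited from the order on positions.\<close>

lemma acyclic_precedes:
  assumes "distinct L"
  shows "acyclic (precedes L)"
proof -
  have "trans (precedes L)"
  proof (rule transI)
    fix x y z assume "(x, y) \<in> precedes L" "(y, z) \<in> precedes L"
    then obtain i j k l where *: "x = L ! i" "y = L ! j" "i < j" "j < length L"
      "y = L ! k" "z = L ! l" "k < l" "l < length L"
      unfolding precedes_def by blast
    then have "j = k" using assms nth_eq_iff_index_eq[of L j k] by simp
    with * have "i < l" by simp
    with * show "(x, z) \<in> precedes L" unfolding precedes_def by blast
  qed
  moreover have "irrefl (precedes L)"
    using assms by (auto simp: irrefl_def precedes_def nth_eq_iff_index_eq)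
  ultimately show ?thesis by (simp add: acyclic_irrefl)
qed

lemma precedes_append:
  assumes "x \<in> set xs" "y \<in> set ys"
  shows "(x, y) \<in> precedes (xs @ ys)"
proof -
  obtain i j where "i < length xs" "x = xs ! i" "j < length ys" "y = ys ! j"
    using assms by (auto simp: in_set_conv_nth)
  then have "x = (xs @ ys) ! i \<and> y = (xs @ ys) ! (length xs + j) \<and>
      i < length xs + j \<and> length xs + j < length (xs @ ys)"
    by (simp add: nth_append)
  then show ?thesis unfolding precedes_def by blast
qed

lemma precedes_appendD:
  assumes "distinct (xs @ y # ys)" "(x, y) \<in> precedes (xs @ y # ys)"
  shows "x \<in> set xs"
proof -
  obtain i j where *: "x = (xs @ y # ys) ! i" "(xs @ y # ys) ! j = y" "i < j"
      "j < length (xs @ y # ys)"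
    using assms(2) unfolding precedes_def by force
  then have "j = length xs"
    using assms(1) nth_eq_iff_index_eq[of "xs @ y # ys" j "length xs"] by simp
  with * show ?thesis by (simp add: nth_append)
qed

text \<open>The sortedness assumption, shaped like the one in \<open>execution_path\<close>, only
  forbids backward pairs. Positions are linearly ordered and acyclicity excludes equal ones, so a
  related pair must point forward.\<close>

lemma trancl_subset_precedes:
  assumes "R \<subseteq> set L \<times> set L" "acyclic R" "sorted_wrt (\<lambda>x y. (y, x) \<notin> R\<^sup>+) L"
  shows "R\<^sup>+ \<subseteq> precedes L"
proof (rule subrelI)
  fix x y assume xy: "(x, y) \<in> R\<^sup>+"
  with assms(1) have "x \<in> set L" "y \<in> set L"
    using trancl_subset_Sigma by blast+
  then obtain i j where *: "i < length L" "x = L ! i" "j < length L" "y = L ! j"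
    by (auto simp: in_set_conv_nth)
  have "i \<noteq> j" using xy * assms(2) by (auto simp: acyclic_def)
  moreover have "\<not> j < i" using xy * assms(3) by (auto simp: sorted_wrt_iff_nth_less)
  ultimately have "i < j" by simp
  with * show "(x, y) \<in> precedes L" unfolding precedes_def by blast
qed

text \<open>Carries a path over from the template to the plan. Gateways drop out, since
  \<open>synthesized_from\<close> compares reachability only between images of actions under
  \<open>node_of\<close>.\<close>

lemma execution_path_linearizes:
  fixes P :: "('v, 'o, 't, 'a) plan" and PT :: "('t, 'a, 'g) template"
  assumes plan: "partial_plan D \<Pi> P" "acyclic (orderings P)"
    and PT: "synthesized_from PT P" and path: "execution_path PT as"
  shows "distinct (Init # map Act as @ [Final])"
    and "set (Init # map Act as @ [Final]) = acts P"
    and "(orderings P)\<^sup>+ \<subseteq> precedes (Init # map Act as @ [Final])"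
proof -
  let ?L = "Init # map Act as @ [Final]"
  show "distinct ?L"
    using path by (auto simp: execution_path_def distinct_map inj_on_def)
  have nodes: "node_of a \<in> nodes PT \<longleftrightarrow> a \<in> acts P" for a
    using PT by (auto simp: synthesized_from_def)
  have "set as = {a. Act a \<in> acts P}"
    using path nodes[of "Act _"] by (simp add: execution_path_def)
  moreover have "a \<in> range Act" if "a \<noteq> Init" "a \<noteq> Final" for a :: "'a act"
    using that by (cases a) auto
  ultimately show L: "set ?L = acts P"
    using plan(1) by (auto simp: partial_plan_def)
  have "StartEvent # map TaskNode as @ [EndEvent] = (map node_of ?L :: ('a, 'g) node list)" by simp
  with path have "sorted_wrt (\<lambda>x y. (y, x) \<notin> (transitions PT)\<^sup>+) (map node_of ?L)"
    unfolding execution_path_def by argo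
  moreover have "(node_of y, node_of x) \<in> (transitions PT)\<^sup>+ \<longleftrightarrow> (y, x) \<in> (orderings P)\<^sup>+"
    if "x \<in> set ?L" "y \<in> set ?L" for x y
    using that PT unfolding L synthesized_from_def by blast
  ultimately have "sorted_wrt (\<lambda>x y. (y, x) \<notin> (orderings P)\<^sup>+) ?L"
    unfolding sorted_wrt_map by (blast intro: sorted_wrt_mono_rel[rotated])
  moreover have "orderings P \<subseteq> set ?L \<times> set ?L"
    using plan(1) unfolding L partial_plan_def by blast
  ultimately show "(orderings P)\<^sup>+ \<subseteq> precedes ?L"
    using plan(2) by (intro trancl_subset_precedes)
qed

text \<open>Invariant of a run: \<open>X\<close> collects the executed actions, and the pending
  links are those leaving \<open>X\<close>.\<close>

definition links_protected :: "('v, 'o, 't, 'a) plan \<Rightarrow> 'a act set \<Rightarrow> ('v, 'o) state \<Rightarrow> bool" where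
  "links_protected P X s \<longleftrightarrow> (\<forall>(c, p, d) \<in> links P. c \<in> X \<longrightarrow> d \<notin> X \<longrightarrow> holds s p)"

text \<open>Each precondition of \<open>b\<close> labels a link into \<open>b\<close>, whose
  producer is ordered before \<open>b\<close> and so lies in \<open>xs\<close>; this link is still
  pending.\<close>

lemma links_protected_sat_pre:
  assumes sol: "solution_plan D \<Pi> P"
    and L: "distinct (xs @ b # ys)" "set (xs @ b # ys) = acts P"
      "(orderings P)\<^sup>+ \<subseteq> precedes (xs @ b # ys)"
    and prot: "links_protected P (set xs) s"
  shows "sat s (act_pre D \<Pi> P b)"
  unfolding sat_def
proof
  fix p assume p: "p \<in> act_pre D \<Pi> P b"
  have "b \<in> acts P" using L(2) by auto
  then obtain c where c: "(c, p, b) \<in> links P"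
    using sol p by (auto simp: solution_plan_def open_condition_def)
  then have "(c, b) \<in> precedes (xs @ b # ys)"
    using sol L(3) by (auto simp: solution_plan_def partial_plan_def)
  then have "c \<in> set xs" using precedes_appendD L(1) by metis
  with c prot L(1) show "holds s p" by (auto simp: links_protected_def)
qed

text \<open>A link pending after \<open>b\<close> either starts at \<open>b\<close>, so that
  \<open>has_effect\<close> yields its label, or was pending before, and then \<open>b\<close>
  cannot falsify the label without being a threat.\<close>

lemma links_protected_step:
  assumes sol: "solution_plan D \<Pi> P"
    and L: "distinct (xs @ b # ys)" "set (xs @ b # ys) = acts P"
      "(orderings P)\<^sup>+ \<subseteq> precedes (xs @ b # ys)"
    and s: "s \<in> states D" "sat s (act_pre D \<Pi> P b)"
    and prot: "links_protected P (set xs) s"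
  shows "links_protected P (insert b (set xs)) (act_result D \<Pi> P b s)"
  unfolding links_protected_def
proof (intro ballI case_prodI2 impI, hypsubst)
  fix c p d assume l: "(c, p, d) \<in> links P" and c: "c \<in> insert b (set xs)"
    and d: "d \<notin> insert b (set xs)"
  have link: "c \<in> acts P" "d \<in> acts P" "has_effect D \<Pi> P c p"
    using sol l by (auto simp: solution_plan_def partial_plan_def)
  show "holds (act_result D \<Pi> P b s) p"
  proof (cases "c = b")
    case True
    then show ?thesis using link(3) s by (auto simp: has_effect_def)
  next
    case False
    with c have cxs: "c \<in> set xs" by simp
    have dys: "d \<in> set ys" using d link(2) L(2) by auto
    have "holds s p" using l cxs d prot by (auto simp: links_protected_def)
    moreover have "\<not> makes_false D \<Pi> P b p"
    proof
      assume false: "makes_false D \<Pi> P b p"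
      have "(c, b) \<in> precedes (xs @ b # ys)"
        using precedes_append[OF cxs, of b "b # ys"] by simp
      moreover have "(b, d) \<in> precedes (xs @ b # ys)"
        using precedes_append[of b "xs @ [b]" d ys] dys by simp
      \<comment> \<open>Both constraints placing \<open>b\<close> between \<open>c\<close> and
        \<open>d\<close> agree with the list order, so the extended orderings lie inside an acyclic
        relation.\<close>
      ultimately have "orderings P \<union> {(c, b), (b, d)} \<subseteq> precedes (xs @ b # ys)"
        using L(3) by auto
      then have "acyclic (orderings P \<union> {(c, b), (b, d)})"
        using acyclic_precedes[OF L(1)] acyclic_subset by blast
      moreover have "b \<in> acts P - {c, d}" using L(2) False d by auto
      ultimately have "conflict D \<Pi> P b (c, p, d)"
        using false unfolding conflict_def by blast
      with sol l show False by (auto simp: solution_plan_def consistent_plan_def)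
    qed
    ultimately show ?thesis using s by (auto simp: makes_false_def)
  qed
qed

text \<open>The executed prefix \<open>xs\<close> is kept general because the induction moves one
  action at a time from the remaining path into it.\<close>

lemma executable_from_links_protected:
  assumes "domain_theory D" "solution_plan D \<Pi> P"
    and "distinct (xs @ map Act as @ [Final])" "set (xs @ map Act as @ [Final]) = acts P"
      "(orderings P)\<^sup>+ \<subseteq> precedes (xs @ map Act as @ [Final])"
    and "s \<in> states D" "links_protected P (set xs) s"
  shows "executable_from D (prob_goal \<Pi>) s (map (task_of P) as)"
  using assms(3-)
proof (induction as arbitrary: xs s)
  case Nil
  \<comment> \<open>Only \<open>Final\<close> is left, and its preconditions are the goal.\<close>
  then show ?case
    using links_protected_sat_pre[OF assms(2), of xs Final "[]" s] by simp
next
  case (Cons a as)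
  let ?b = "Act a" and ?ys = "map Act as @ [Final]"
  have L: "distinct (xs @ ?b # ?ys)" "set (xs @ ?b # ?ys) = acts P"
      "(orderings P)\<^sup>+ \<subseteq> precedes (xs @ ?b # ?ys)"
    using Cons.prems by simp_all
  note pre = links_protected_sat_pre[OF assms(2) L Cons.prems(5)]
  note step = links_protected_step[OF assms(2) L Cons.prems(4) pre Cons.prems(5)]
  have "Act a \<in> acts P" using L(2) by auto
  then have "task_of P a \<in> tasks D"
    using assms(2) by (auto simp: solution_plan_def partial_plan_def)
  then have "update s (eff D (task_of P a)) \<in> states D"
    using assms(1) Cons.prems(4) by (intro update_in_states) (auto simp: domain_theory_def)
  then have "executable_from D (prob_goal \<Pi>) (update s (eff D (task_of P a))) (map (task_of P) as)"
    using Cons.IH[of "xs @ [?b]"] L step by simp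
  with pre show ?case by simp
qed

theorem theorem5:
  fixes D :: "('v, 'o, 't) domain_theory"
    and \<Pi> :: "('v, 'o) problem"
    and P :: "('v, 'o, 't, 'a) plan"
    and PT :: "('t, 'a, 'g) template"
    and C :: "('v, 'o) process_case"
  assumes "domain_theory D"
    and "planning_problem D \<Pi>"
    and "solution_plan D \<Pi> P"
    and "synthesized_from PT P"
    and "process_case D C"
    and "case_goal C = prob_goal \<Pi>"
    and "init_satisfies D C (weakest_preconditions P)"
  shows "correct D C PT"
  unfolding correct_def template_executable_def path_executable_def
proof (intro allI impI ballI)
  fix as s assume path: "execution_path PT as" and s: "s \<in> initial_states D C"
  have plan: "partial_plan D \<Pi> P" "acyclic (orderings P)"
    using assms(3) by (auto simp: solution_plan_def consistent_plan_def)
  note L = execution_path_linearizes[OF plan assms(4) path]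
  \<comment> \<open>\<open>Init\<close> counts as executed at the start, but \<open>s\<close> comes
    from the case and may differ from \<open>prob_init \<Pi>\<close>. Hence the labels of links from
    \<open>Init\<close> hold by \<open>init_satisfies\<close>, not by
    \<open>has_effect\<close>.\<close>
  have "links_protected P (set [Init]) s"
    using assms(7) s plan(1)
    by (fastforce simp: links_protected_def init_satisfies_def sat_def
        weakest_preconditions_def partial_plan_def)
  moreover have "s \<in> states D" using s by (simp add: initial_states_def)
  ultimately have "executable_from D (prob_goal \<Pi>) s (map (task_of P) as)"
    using executable_from_links_protected[OF assms(1,3), of "[Init]" as s] L by simp
  moreover have "Act a \<in> acts P" if "a \<in> set as" for a
    using that L(2) by auto
  then have "map (node_task PT) as = map (task_of P) as"
    using assms(4) by (simp add: synthesized_from_def)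
  ultimately show "executable_from D (case_goal C) s (map (node_task PT) as)"
    using assms(6) by (simp only:)
qed

end
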